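(* Let $p$ be a prime and $k$ a positive integer, and let $n$ be a positive integer. Any matrix in $M_n(\mathbb{Z}_{p^k})$ that is diagonalizable over $\mathbb{Z}_{p^k}$ is similar (over $\mathbb{Z}_{p^k}$) to exactly one diagonal matrix, up to the ordering of its diagonal entries. That is, a diagonalizable matrix is similar to some diagonal matrix, and if it is similar to two diagonal matrices $D = \mathrm{diag}(d_1,\dots,d_n)$ and $D' = \mathrm{diag}(d_1',\dots,d_n')$ in $M_n(\mathbb{Z}_{p^k})$, then there is a permutation $\sigma \in S_n$ with $d_i = d'_{\sigma(i)}$ for all $i$.
   Context: $\mathbb{Z}_{p^k}$ denotes the ring of integers modulo $p^k$. For a commutative ring $R$ with unity, $M_n(R)$ is the ring of $n\times n$ matrices over $R$ and $GL_n(R)$ its group of invertible matrices. Matrices $A,B\in M_n(R)$ are similar (over $R$) if $B = PAP^{-1}$ for some $P\in GL_n(R)$. A matrix $A \in M_n(R)$ is diagonalizable over $R$ if $A = PDP^{-1}$ for some $P\in GL_n(R)$ and some diagonal matrix $D\in M_n(R)$. *)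

theory Defs
  imports
    "HOL-Combinatorics.Permutations"
    "Jordan_Normal_Form.Matrix"
    "Berlekamp_Zassenhaus.Finite_Field"
begin

definition diagonalizable_mat :: "'a::comm_ring_1 mat \<Rightarrow> bool" where
  "diagonalizable_mat A \<longleftrightarrow> (\<exists>D. diagonal_mat D \<and> similar_mat A D)"

end

theory Submission
  imports Defs "Jordan_Normal_Form.Determinant"
begin

text \<open>
  A residue ring of prime power order is local: every element not divisible by \<open>p\<close> is a unit.
  If \<open>P\<close> is invertible, its determinant is not divisible by \<open>p\<close>, so neither is some term of the
  Leibniz expansion; this yields a permutation \<open>\<sigma>\<close> for which all the entries \<open>P $$ (i, \<sigma> i)\<close> are units.
  Comparing the entries of \<open>D P = P D'\<close> at these positions and cancelling gives \<open>D $$ (i, i) = D' $$ (\<sigma> i, \<sigma> i)\<close>.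
\<close>

text \<open>The two hypotheses on \<open>q\<close> together say that the non-units are exactly the
  multiples of \<open>q\<close>, so the ring is local with principal maximal ideal. Stating it this
  way keeps the matrix argument free of residue arithmetic.\<close>

lemma unit_entries_of_invertible:
  fixes P Q :: "'a::comm_ring_1 mat" and q :: 'a
  assumes P: "P \<in> carrier_mat n n" and Q: "Q \<in> carrier_mat n n" and PQ: "P * Q = 1\<^sub>m n"
    and q: "\<not> q dvd 1" and local: "\<And>x. \<not> q dvd x \<Longrightarrow> x dvd 1"
  obtains \<sigma> where "\<sigma> permutes {..<n}" and "\<And>i. i < n \<Longrightarrow> P $$ (i, \<sigma> i) dvd 1"
proof -
  have "det P * det Q = 1"
    using det_mult[OF P Q] PQ by simp
  then have "\<not> q dvd det P"
    using q dvd_mult2[of q "det P" "det Q"] by auto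
  \<comment> \<open>By contraposition: if \<open>q\<close> divided every Leibniz term, it would
    divide their sum \<open>det P\<close>.\<close>
  then have "\<exists>\<sigma>\<in>{\<sigma>. \<sigma> permutes {0..<n}}. \<not> q dvd signof \<sigma> * (\<Prod>i = 0..<n. P $$ (i, \<sigma> i))"
    unfolding det_def'[OF P] by (rule contrapos_np) (auto intro!: dvd_sum)
  then obtain \<sigma> where \<sigma>: "\<sigma> permutes {0..<n}"
    and leibniz: "\<not> q dvd signof \<sigma> * (\<Prod>i = 0..<n. P $$ (i, \<sigma> i))"
    by auto
  from leibniz have prod: "\<not> q dvd (\<Prod>i = 0..<n. P $$ (i, \<sigma> i))"
    by (rule contrapos_nn) (rule dvd_mult)
  \<comment> \<open>A multiple of \<open>q\<close> among the factors would make the whole product a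
    multiple of \<open>q\<close>.\<close>
  have "P $$ (i, \<sigma> i) dvd 1" if "i < n" for i
  proof (rule local, rule notI)
    assume "q dvd P $$ (i, \<sigma> i)"
    moreover have "P $$ (i, \<sigma> i) dvd (\<Prod>i = 0..<n. P $$ (i, \<sigma> i))"
      using that by (intro dvd_prodI) auto
    ultimately show False
      using prod dvd_trans by blast
  qed
  with \<sigma> show thesis
    using that by (simp add: atLeast0LessThan)
qed

text \<open>Since the ring may have zero divisors, nonzero entries of \<open>P\<close> would not
  allow cancellation; the permutation is therefore taken from the unit entries.\<close>

lemma similar_diagonal_mats_permuted:
  fixes D D' :: "'a::comm_ring_1 mat" and q :: 'a
  assumes D: "D \<in> carrier_mat n n" "diagonal_mat D"
    and D': "D' \<in> carrier_mat n n" "diagonal_mat D'"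
    and sim: "similar_mat D D'"
    and q: "\<not> q dvd 1" and local: "\<And>x. \<not> q dvd x \<Longrightarrow> x dvd 1"
  obtains \<sigma> where "\<sigma> permutes {..<n}" and "\<And>i. i < n \<Longrightarrow> D $$ (i, i) = D' $$ (\<sigma> i, \<sigma> i)"
proof -
  from sim obtain P Q where "similar_mat_wit D D' P Q"
    unfolding similar_mat_def by blast
  note wit = similar_mat_witD2[OF D(1) this]
  then have P: "P \<in> carrier_mat n n" and Q: "Q \<in> carrier_mat n n" by auto
  \<comment> \<open>Multiply \<open>D = P * D' * Q\<close> by \<open>P\<close> on the right; then
    \<open>Q * P\<close> collapses to the identity.\<close>
  have "D * P = P * D' * (Q * P)"
    using wit(3) P Q D'(1) by (simp add: assoc_mult_mat[of _ n n _ n _ n])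
  then have DP: "D * P = P * D'"
    using wit(2) P D'(1) by simp
  obtain \<sigma> where \<sigma>: "\<sigma> permutes {..<n}" and unit: "\<And>i. i < n \<Longrightarrow> P $$ (i, \<sigma> i) dvd 1"
    using unit_entries_of_invertible[OF P Q wit(1) q local] by blast
  have "D $$ (i, i) = D' $$ (\<sigma> i, \<sigma> i)" if i: "i < n" for i
  proof -
    have j: "\<sigma> i < n"
      using permutes_in_image[OF \<sigma>] i by auto
    have "(D * P) $$ (i, \<sigma> i) = (\<Sum>l = 0..<n. D $$ (i, l) * P $$ (l, \<sigma> i))"
      using D P i j by (simp add: scalar_prod_def)
    also have "\<dots> = (\<Sum>l = 0..<n. if l = i then D $$ (i, i) * P $$ (i, \<sigma> i) else 0)"
      using D i by (intro sum.cong) (auto simp: diagonal_mat_def)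
    also have "\<dots> = D $$ (i, i) * P $$ (i, \<sigma> i)"
      using i by simp
    finally have lhs: "(D * P) $$ (i, \<sigma> i) = D $$ (i, i) * P $$ (i, \<sigma> i)" .
    have "(P * D') $$ (i, \<sigma> i) = (\<Sum>l = 0..<n. P $$ (i, l) * D' $$ (l, \<sigma> i))"
      using D' P i j by (simp add: scalar_prod_def)
    also have "\<dots> = (\<Sum>l = 0..<n. if l = \<sigma> i then P $$ (i, \<sigma> i) * D' $$ (\<sigma> i, \<sigma> i) else 0)"
      using D' j by (intro sum.cong) (auto simp: diagonal_mat_def)
    also have "\<dots> = P $$ (i, \<sigma> i) * D' $$ (\<sigma> i, \<sigma> i)"
      using j by simp
    finally have "D $$ (i, i) * P $$ (i, \<sigma> i) = D' $$ (\<sigma> i, \<sigma> i) * P $$ (i, \<sigma> i)"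
      using lhs DP by (simp add: mult.commute)
    \<comment> \<open>The factor \<open>u\<close> will be the inverse of the unit
      \<open>P $$ (i, \<sigma> i)\<close>.\<close>
    then have "D $$ (i, i) * (P $$ (i, \<sigma> i) * u) = D' $$ (\<sigma> i, \<sigma> i) * (P $$ (i, \<sigma> i) * u)" for u
      by (simp flip: mult.assoc)
    moreover obtain u where "1 = P $$ (i, \<sigma> i) * u"
      using unit[OF i] by (elim dvdE)
    ultimately show ?thesis
      by (metis mult.right_neutral)
  qed
  with \<sigma> show thesis
    using that by blast
qed

text \<open>The image of \<open>p\<close> is nilpotent, its \<open>k\<close>-th power being the
  cardinality of the ring, hence 0. A nilpotent unit would force 0 to divide 1.\<close>

lemma not_dvd_1_mod_ring_power:
  assumes "CARD('a::nontriv) = p ^ k"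
  shows "\<not> (of_nat p :: 'a mod_ring) dvd 1"
proof
  assume "(of_nat p :: 'a mod_ring) dvd 1"
  then have "(of_nat p :: 'a mod_ring) ^ k dvd 1"
    using dvd_power_same[of "of_nat p :: 'a mod_ring" 1 k] by simp
  moreover have "(of_nat p :: 'a mod_ring) ^ k = 0"
    using assms of_nat_card_eq_0[where 'a = 'a] by (simp flip: of_nat_power)
  ultimately show False by simp
qed

text \<open>An integer representative of \<open>x\<close> is coprime to \<open>p ^ k\<close>, and a
  Bezout identity reduced modulo \<open>p ^ k\<close> exhibits the inverse.\<close>

lemma unit_mod_ring_if_not_prime_dvd:
  fixes x :: "'a::nontriv mod_ring"
  assumes "prime p" and card: "CARD('a) = p ^ k" and x: "\<not> of_nat p dvd x"
  shows "x dvd 1"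
proof -
  define m where "m = to_int_mod_ring x"
  have m: "of_int m = x"
    by (simp add: m_def of_int_of_int_mod_ring)
  \<comment> \<open>A factorization of \<open>m\<close> through \<open>p\<close> would map under
    \<open>of_int\<close> to one of \<open>x\<close>.\<close>
  have "\<not> int p dvd m"
    using x m by auto
  then have "coprime m (int p ^ k)"
    using assms(1) by (metis coprime_commute coprime_power_right_iff prime_imp_coprime prime_nat_int_transfer)
  then obtain u v where "u * m + v * int p ^ k = 1"
    using bezout_int[of m "int p ^ k"] by (auto simp: coprime_iff_gcd_eq_1)
  then have "of_int (u * m + v * int p ^ k) = (1 :: 'a mod_ring)"
    by simp
  moreover have "(of_nat p :: 'a mod_ring) ^ k = 0"
    using card of_nat_card_eq_0[where 'a = 'a] by (simp flip: of_nat_power)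
  ultimately have "of_int u * x = 1"
    using m by simp
  then show ?thesis
    using dvd_triv_right[of x "of_int u"] by simp
qed

theorem theorem2p1:
  fixes A :: "'a::nontriv mod_ring mat" and p k n :: nat
  assumes "prime p" and "k > 0" and "n > 0"
    and "CARD('a) = p ^ k"
    and "A \<in> carrier_mat n n"
    and "diagonalizable_mat A"
  shows "(\<exists>D \<in> carrier_mat n n. diagonal_mat D \<and> similar_mat A D) \<and>
    (\<forall>D \<in> carrier_mat n n. \<forall>D' \<in> carrier_mat n n.
       diagonal_mat D \<and> diagonal_mat D' \<and> similar_mat A D \<and> similar_mat A D' \<longrightarrow>
       (\<exists>\<sigma>. \<sigma> permutes {..<n} \<and> (\<forall>i<n. D $$ (i, i) = D' $$ (\<sigma> i, \<sigma> i))))"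
proof (intro conjI ballI impI; (elim conjE)?)
  obtain D where "diagonal_mat D" "similar_mat A D"
    using assms(6) unfolding diagonalizable_mat_def by blast
  moreover from this(2) have "D \<in> carrier_mat n n"
    using assms(5) by (auto simp: similar_mat_def similar_mat_wit_def Let_def)
  ultimately show "\<exists>D \<in> carrier_mat n n. diagonal_mat D \<and> similar_mat A D"
    by blast
next
  fix D D' assume D: "D \<in> carrier_mat n n" "diagonal_mat D" "similar_mat A D"
    and D': "D' \<in> carrier_mat n n" "diagonal_mat D'" "similar_mat A D'"
  \<comment> \<open>\<open>A\<close> links the two diagonal matrices, so the local-ring result
    applies with \<open>p\<close> in the role of \<open>q\<close>.\<close>
  have "similar_mat D D'"
    using D(3) D'(3) similar_mat_sym similar_mat_trans by blast
  then show "\<exists>\<sigma>. \<sigma> permutes {..<n} \<and> (\<forall>i<n. D $$ (i, i) = D' $$ (\<sigma> i, \<sigma> i))"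
    using similar_diagonal_mats_permuted[OF D(1,2) D'(1,2) _ not_dvd_1_mod_ring_power[OF assms(4)]
        unit_mod_ring_if_not_prime_dvd[OF assms(1,4)]] by blast
qed

end
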